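(* Let $r\ge 1$ be an integer and let $\lambda>0$, $\mu>0$, $\kappa>0$. Put $\theta=\lambda/\mu$, $\gamma=\kappa/\mu$, $$\alpha=\frac{r+\theta+\gamma-\sqrt{(r+\theta+\gamma)^2-4\theta r}}{2r},$$ $$A_n=\int_0^1\gamma(1-s)^{\gamma-1}s^n e^{-\theta s}\,ds\quad(n=0,1,\dots),$$ $$C_k=\sum_{l=0}^k\binom{k}{l}\gamma(\gamma+1)\cdots(\gamma+l-1)\,\theta^{-l}\quad(k=0,1,\dots),$$ $$L_{r-1,r}=\frac{\theta A_r-r\alpha A_{r-1}}{\theta C_r-r\alpha C_{r-1}}.$$ Then the stationary distribution $\pi=(\pi_k)_{k\ge 0}$ of the M/M/$r$ queue with random resetting (the continuous-time Markov chain on $\mathbb{Z}_+$ described in the context) is given by $$\pi_k=\frac{\theta^k}{k!}\left(A_k-L_{r-1,r}C_k\right),\qquad k=0,1,\dots,r-1,$$ and, for $k\ge r$, $$\pi_k=\alpha^{k-r+1}\pi_{r-1}=\frac{\alpha^{k-r+1}\theta^{r-1}}{(r-1)!}\left(A_{r-1}-L_{r-1,r}C_{r-1}\right).$$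
   Context: The M/M/$r$ queue with random resetting is the continuous-time Markov chain $\{X(t):t\ge 0\}$ on $\mathbb{Z}_+=\{0,1,2,\dots\}$ with the following transition mechanisms: from $i\ge 0$ to $i+1$ at rate $\lambda$ (arrival); from $i\ge1$ to $i-1$ at rate $(i\wedge r)\mu$ (departure); from $i\ge 1$ to $0$ at rate $\kappa$ (resetting). (From state $1$ to $0$ the departure and resetting rates add up.) Here $x\wedge y=\min\{x,y\}$. This chain has a unique stationary distribution. The empty product $\gamma(\gamma+1)\cdots(\gamma+l-1)$ for $l=0$ equals $1$. *)

theory Defs
  imports "HOL-Probability.Probability"
begin

(* P t x is the law at time t of the chain started in x; the second equation is
   Chapman-Kolmogorov.  Negative times are irrelevant. *)
definition transition_function :: "(real \<Rightarrow> 'a \<Rightarrow> 'a pmf) \<Rightarrow> bool" where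
  "transition_function P \<longleftrightarrow>
     (\<forall>x. P 0 x = return_pmf x) \<and>
     (\<forall>s\<ge>0. \<forall>t\<ge>0. \<forall>x. P (s + t) x = bind_pmf (P s x) (P t))"

(* The derivative of P at time 0+ is the conservative Q-matrix with off-diagonal entries q x y
   and diagonal entries -(SUM y. q x y), where the sum runs over y \<noteq> x.  Values q x x are
   ignored. *)
definition has_transition_rates :: "(real \<Rightarrow> 'a \<Rightarrow> 'a pmf) \<Rightarrow> ('a \<Rightarrow> 'a \<Rightarrow> real) \<Rightarrow> bool" where
  "has_transition_rates P q \<longleftrightarrow>
     (\<forall>x y. x \<noteq> y \<longrightarrow> ((\<lambda>h. pmf (P h x) y / h) \<longlongrightarrow> q x y) (at_right 0)) \<and>
     (\<forall>x. ((\<lambda>h. (1 - pmf (P h x) x) / h) \<longlongrightarrow> (\<Sum>\<^sub>\<infinity>y\<in>-{x}. q x y)) (at_right 0))"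

definition stationary_distribution :: "(real \<Rightarrow> 'a \<Rightarrow> 'a pmf) \<Rightarrow> 'a pmf \<Rightarrow> bool" where
  "stationary_distribution P p \<longleftrightarrow> (\<forall>t\<ge>0. bind_pmf p (P t) = p)"

(* The summands are arrival, departure and resetting; the last two add up for the
   transition from 1 to 0. *)
definition mmr_reset_rate :: "nat \<Rightarrow> real \<Rightarrow> real \<Rightarrow> real \<Rightarrow> nat \<Rightarrow> nat \<Rightarrow> real" where
  "mmr_reset_rate r lam \<mu> \<kappa> i j =
     (if j = i + 1 then lam else 0) +
     (if i \<ge> 1 \<and> j = i - 1 then real (min i r) * \<mu> else 0) +
     (if i \<ge> 1 \<and> j = 0 then \<kappa> else 0)"

(* With bounded rates as here, the rates determine P, so P is the transition function of
   the M/M/r queue with random resetting. *)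
definition mmr_reset_queue ::
    "nat \<Rightarrow> real \<Rightarrow> real \<Rightarrow> real \<Rightarrow> (real \<Rightarrow> nat \<Rightarrow> nat pmf) \<Rightarrow> bool" where
  "mmr_reset_queue r lam \<mu> \<kappa> P \<longleftrightarrow>
     transition_function P \<and> has_transition_rates P (mmr_reset_rate r lam \<mu> \<kappa>)"

(* For \<gamma> < 1 the integrand is unbounded at s = 1 but integrable; its value at s = 1 is
   immaterial. *)
definition A_coeff :: "real \<Rightarrow> real \<Rightarrow> nat \<Rightarrow> real" where
  "A_coeff \<theta> \<gamma> n =
     integral {0..1} (\<lambda>s. \<gamma> * (1 - s) powr (\<gamma> - 1) * s ^ n * exp (- \<theta> * s))"

definition C_coeff :: "real \<Rightarrow> real \<Rightarrow> nat \<Rightarrow> real" where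
  "C_coeff \<theta> \<gamma> k = (\<Sum>l\<le>k. real (k choose l) * pochhammer \<gamma> l / \<theta> ^ l)"

end

theory Submission
  imports Defs
begin

text \<open>The rates are bounded, so the generator of the queue is c times the difference of a
  transition kernel K on the states and the identity. Dominated convergence shows that a law is
  stationary for the transition function iff it is invariant under K. Since K resets to 0 with
  probability bounded below, an invariant law exists. Invariance under K amounts to the balance
  equations: from r on they are a linear recurrence with constant coefficients whose second
  characteristic root exceeds 1, so a bounded solution is geometric with ratio \<alpha>. Below r, after
  the substitution p k = \<theta>^k / k! * u k, they become a recurrence that A satisfies and whose
  homogeneous version is satisfied by C. Matching the two at r - 1 and r determines L.\<close>

section \<open>Bounded functions under a pmf\<close>

lemma integrable_measure_pmf_bounded:
  fixes f :: "'a \<Rightarrow> real"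
  assumes "\<And>x. \<bar>f x\<bar> \<le> B"
  shows "integrable (measure_pmf M) f"
  using assms by (intro measure_pmf.integrable_const_bound[where B = B]) auto

text \<open>For nonnegative functions the identity holds for \<open>nn_integral\<close> without any
  condition; the bound \<open>B\<close> makes every integral finite, so that it carries over to real
  expectations.\<close>

lemma expectation_bind_pmf:
  fixes f :: "'a \<Rightarrow> real"
  assumes f: "\<And>x. 0 \<le> f x" "\<And>x. f x \<le> B"
  shows "measure_pmf.expectation (bind_pmf M N) f =
         measure_pmf.expectation M (\<lambda>x. measure_pmf.expectation (N x) f)"
proof -
  have B: "\<bar>f x\<bar> \<le> B" for x
    using f[of x] by simp
  have int: "integrable (measure_pmf Q) f" for Q
    by (rule integrable_measure_pmf_bounded[OF B])
  have le: "measure_pmf.expectation Q f \<le> B" for Q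
    using integral_mono[OF int, of Q "\<lambda>_. B"] f by simp
  have nonneg: "0 \<le> measure_pmf.expectation Q f" for Q
    using f by simp
  have int2: "integrable (measure_pmf M) (\<lambda>x. measure_pmf.expectation (N x) f)"
    using le nonneg by (intro integrable_measure_pmf_bounded[where B = B]) simp
  have "ennreal (measure_pmf.expectation (bind_pmf M N) f) = (\<integral>\<^sup>+x. f x \<partial>bind_pmf M N)"
    using f by (intro nn_integral_eq_integral[symmetric] int) auto
  also have "\<dots> = (\<integral>\<^sup>+x. measure_pmf.expectation (N x) f \<partial>M)"
    using f by (simp add: nn_integral_eq_integral[OF int])
  also have "\<dots> = ennreal (measure_pmf.expectation M (\<lambda>x. measure_pmf.expectation (N x) f))"
    using nonneg by (intro nn_integral_eq_integral int2) auto
  finally show ?thesis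
    using nonneg by simp
qed

text \<open>Passing through \<open>x\<close> is only one of the ways to reach \<open>y\<close> in
  two stages.\<close>

lemma pmf_mult_le_pmf_bind: "pmf M x * pmf (f x) y \<le> pmf (bind_pmf M f) y"
proof -
  have "pmf M x * pmf (f x) y = measure_pmf.expectation M (\<lambda>z. indicator {x} z * pmf (f x) y)"
    by (simp add: measure_pmf_single)
  also have "\<dots> \<le> measure_pmf.expectation M (\<lambda>z. pmf (f z) y)"
    by (intro integral_mono integrable_measure_pmf_bounded[where B = 1])
       (auto simp: indicator_def pmf_le_1)
  finally show ?thesis
    by (simp add: pmf_bind)
qed

section \<open>Exit probabilities of a transition function\<close>

lemma filterlim_divide_Suc_at_right_0:
  fixes t :: real
  assumes "t > 0"
  shows "filterlim (\<lambda>n. t / real (Suc n)) (at_right 0) sequentially"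
proof (rule tendsto_imp_filterlim_at_right)
  show "(\<lambda>n. t / real (Suc n)) \<longlonglongrightarrow> 0"
    by (intro tendsto_divide_0[OF tendsto_const] filterlim_at_top_imp_at_infinity
        filterlim_compose[OF filterlim_real_sequentially] filterlim_Suc)
qed (use assms in simp)

lemma transition_functionD:
  assumes "transition_function P"
  shows "P 0 = return_pmf"
    and "0 \<le> s \<Longrightarrow> 0 \<le> t \<Longrightarrow> P (s + t) x = bind_pmf (P s x) (P t)"
  using assms by (auto simp: transition_function_def)

text \<open>Being found at \<open>x\<close> at each of the times \<open>h\<close>,
  \<open>2 * h\<close>, ..., \<open>n * h\<close> is one way of being there at the last of
  them.\<close>

lemma transition_function_stay_power:
  assumes P: "transition_function P" and h: "0 \<le> h"
  shows "pmf (P h x) x ^ n \<le> pmf (P (real n * h) x) x"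
proof (induction n)
  case 0
  show ?case
    by (simp add: transition_functionD[OF P])
next
  case (Suc n)
  have "pmf (P h x) x ^ Suc n \<le> pmf (P h x) x * pmf (P (real n * h) x) x"
    using Suc by (simp add: mult_left_mono)
  also have "\<dots> \<le> pmf (P (h + real n * h) x) x"
    using pmf_mult_le_pmf_bind[of "P h x" x "P (real n * h)" x] h
    by (simp add: transition_functionD(2)[OF P])
  finally show ?case
    by (simp add: algebra_simps)
qed

text \<open>Split \<open>[0, t]\<close> into \<open>n + 1\<close> equal steps of length
  \<open>h n\<close>. Bernoulli's inequality turns the power bound for staying into a bound for
  leaving that is linear in the exit probability of one step, and this equals \<open>t\<close> times
  the difference quotient at \<open>h n\<close>, which tends to \<open>q\<close>. The estimate holds
  for every \<open>t\<close>, not just in the limit, so it can serve as a dominating bound.\<close>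

lemma transition_function_leave_le:
  assumes P: "transition_function P" and t: "0 \<le> t"
    and q: "((\<lambda>h. (1 - pmf (P h x) x) / h) \<longlongrightarrow> q) (at_right 0)"
  shows "1 - pmf (P t x) x \<le> q * t"
proof (cases "t = 0")
  case True
  then show ?thesis
    by (simp add: transition_functionD[OF P])
next
  case False
  define h where "h n = t / real (Suc n)" for n
  have pos: "0 < h n" for n
    using t False by (simp add: h_def)
  have "filterlim h (at_right 0) sequentially"
    unfolding h_def using t False by (intro filterlim_divide_Suc_at_right_0) simp
  from filterlim_compose[OF q this]
  have "(\<lambda>n. t * ((1 - pmf (P (h n) x) x) / h n)) \<longlonglongrightarrow> t * q"
    by (intro tendsto_intros)
  moreover have "1 - pmf (P t x) x \<le> t * ((1 - pmf (P (h n) x) x) / h n)" for n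
  proof -
    have "1 + real (Suc n) * (pmf (P (h n) x) x - 1) \<le> pmf (P (h n) x) x ^ Suc n"
      using Bernoulli_inequality[of "pmf (P (h n) x) x - 1" "Suc n"] by (simp del: of_nat_Suc)
    also have "\<dots> \<le> pmf (P (real (Suc n) * h n) x) x"
      using pos[of n] by (intro transition_function_stay_power[OF P]) simp
    also have "real (Suc n) * h n = t"
      by (simp add: h_def)
    finally have "1 - pmf (P t x) x \<le> real (Suc n) * (1 - pmf (P (h n) x) x)"
      by (simp add: algebra_simps)
    also have "real (Suc n) = t / h n"
      using False by (simp add: h_def)
    finally show ?thesis
      by simp
  qed
  ultimately show ?thesis
    by (intro LIMSEQ_le_const) (auto simp: mult.commute)
qed

section \<open>Uniformization: stationary laws are the invariant laws of the jump kernel\<close>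

text \<open>Since \<open>has_transition_rates\<close> ignores the diagonal, \<open>K\<close> may
  stay where it is, which lets a single constant \<open>c\<close> serve all states. Finite supports
  reduce the convergence of rates at a state to finitely many targets.\<close>

definition has_uniformization :: "(real \<Rightarrow> 'a \<Rightarrow> 'a pmf) \<Rightarrow> real \<Rightarrow> ('a \<Rightarrow> 'a pmf) \<Rightarrow> bool" where
  "has_uniformization P c K \<longleftrightarrow>
     has_transition_rates P (\<lambda>x y. c * pmf (K x) y) \<and> c > 0 \<and> (\<forall>x. finite (set_pmf (K x)))"

lemma infsum_pmf_finite:
  assumes "finite (set_pmf M)"
  shows "(\<Sum>\<^sub>\<infinity>y\<in>-{x}. c * pmf M y) = c * (1 - pmf M x)"
proof -
  have "(\<Sum>\<^sub>\<infinity>y\<in>-{x}. c * pmf M y) = (\<Sum>y\<in>set_pmf M - {x}. c * pmf M y)"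
    using assms by (subst infsum_cong_neutral[of "set_pmf M - {x}" "-{x}" _ "\<lambda>y. c * pmf M y"])
      (auto simp: set_pmf_iff)
  also have "\<dots> = c * (\<Sum>y\<in>insert x (set_pmf M) - {x}. pmf M y)"
    by (simp add: sum_distrib_left)
  also have "(\<Sum>y\<in>insert x (set_pmf M) - {x}. pmf M y) = 1 - pmf M x"
    using assms by (subst sum_diff1) (simp_all add: sum_pmf_eq_1 subset_insertI)
  finally show ?thesis .
qed

text \<open>Difference quotients of \<open>P\<close> approach the generator uniformly over test
  functions bounded by 1, so the test function may vary with \<open>n\<close>. Pointwise in
  \<open>x\<close> the error is controlled by rates alone; the bound \<open>4 * c\<close>, uniform
  in \<open>x\<close>, then allows dominated convergence under any law \<open>p\<close>.\<close>

lemma expectation_tendsto_uniformized_generator: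
  assumes P: "transition_function P" and K: "has_uniformization P c K"
    and h: "filterlim h (at_right 0) sequentially" "\<And>n. 0 < h n"
    and f: "\<And>n x. \<bar>f n x\<bar> \<le> 1"
  shows "(\<lambda>n. measure_pmf.expectation p (\<lambda>x.
           (measure_pmf.expectation (P (h n) x) (f n) - f n x) / h n
             - c * (measure_pmf.expectation (K x) (f n) - f n x))) \<longlonglongrightarrow> 0"
proof -
  let ?g = "\<lambda>n x. (measure_pmf.expectation (P (h n) x) (f n) - f n x) / h n
             - c * (measure_pmf.expectation (K x) (f n) - f n x)"
  have fin: "finite (set_pmf (K x))" and c: "c > 0" for x
    using K by (auto simp: has_uniformization_def)
  have jump: "((\<lambda>h. pmf (P h x) y / h) \<longlongrightarrow> c * pmf (K x) y) (at_right 0)" if "x \<noteq> y" for x y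
    using K that by (auto simp: has_uniformization_def has_transition_rates_def)
  have leave: "((\<lambda>h. (1 - pmf (P h x) x) / h) \<longlongrightarrow> c * (1 - pmf (K x) x)) (at_right 0)" for x
    using K by (auto simp: has_uniformization_def has_transition_rates_def infsum_pmf_finite)
  have int_f: "integrable (measure_pmf M) (f n)" for M n
    by (rule integrable_measure_pmf_bounded[OF f])
  have int_d: "integrable (measure_pmf M) (\<lambda>y. \<bar>f n y - f n x\<bar>)" for M n x
    using f[of n] by (intro integrable_abs Bochner_Integration.integrable_diff int_f) simp
  have diff: "measure_pmf.expectation M (f n) - f n x = measure_pmf.expectation M (\<lambda>y. f n y - f n x)"
    for M n x by (subst Bochner_Integration.integral_diff) (auto simp: int_f)
  have d2: "\<bar>f n y - f n x\<bar> \<le> 2" for n x y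
    using f[of n x] f[of n y] by linarith
  \<comment> \<open>The increment of \<open>f n\<close> vanishes at \<open>x\<close> and is at most
    2 elsewhere, so only the mass outside \<open>x\<close> counts.\<close>
  have dev: "\<bar>measure_pmf.expectation M (f n) - f n x\<bar> \<le> 2 * (1 - pmf M x)" for M n x
  proof -
    have "\<bar>measure_pmf.expectation M (f n) - f n x\<bar> \<le> measure_pmf.expectation M (\<lambda>y. \<bar>f n y - f n x\<bar>)"
      unfolding diff by (rule integral_abs_bound)
    also have "\<dots> \<le> measure_pmf.expectation M (\<lambda>y. 2 * indicator (- {x}) y)"
      using d2 by (intro integral_mono int_d integrable_measure_pmf_bounded[where B = 2])
        (auto simp: indicator_def)
    also have "\<dots> = 2 * (1 - pmf M x)"
      by (simp add: measure_pmf.prob_compl[of "{x}", simplified] Compl_eq_Diff_UNIV measure_pmf_single)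
    finally show ?thesis .
  qed
  have pointwise: "(\<lambda>n. ?g n x) \<longlonglongrightarrow> 0" for x
  proof -
    \<comment> \<open>Jumps into the finite set \<open>S\<close> are compared target by target;
      jumps outside \<open>S\<close> are charged with all the mass they carry. Neither part of the
      bound involves \<open>f\<close>.\<close>
    define S where "S = insert x (set_pmf (K x))"
    have S: "finite S" "x \<in> S"
      using fin by (auto simp: S_def)
    have bound: "\<bar>?g n x\<bar> \<le>
      2 * (\<Sum>y\<in>S - {x}. \<bar>pmf (P (h n) x) y / h n - c * pmf (K x) y\<bar>) +
      2 * ((1 - pmf (P (h n) x) x) / h n - (\<Sum>y\<in>S - {x}. pmf (P (h n) x) y / h n))" for n
    proof -
      define D where "D y = f n y - f n x" for y
      have D: "\<bar>D y\<bar> \<le> 2" for y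
        using d2 by (simp add: D_def)
      have int_D: "integrable (measure_pmf M) D" for M
        by (rule integrable_measure_pmf_bounded[OF D])
      have EK: "measure_pmf.expectation (K x) D = (\<Sum>y\<in>S - {x}. D y * pmf (K x) y)"
        using S by (intro integral_measure_pmf_real) (auto simp: S_def D_def)
      have "measure_pmf.expectation (P (h n) x) D =
          measure_pmf.expectation (P (h n) x) (\<lambda>y. D y * indicator S y + D y * indicator (-S) y)"
        by (intro Bochner_Integration.integral_cong) (auto simp: indicator_def)
      also have "\<dots> = measure_pmf.expectation (P (h n) x) (\<lambda>y. D y * indicator S y) +
          measure_pmf.expectation (P (h n) x) (\<lambda>y. D y * indicator (-S) y)"
        using D by (intro Bochner_Integration.integral_add
            integrable_measure_pmf_bounded[where B = 2]) (auto simp: indicator_def)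
      also have "measure_pmf.expectation (P (h n) x) (\<lambda>y. D y * indicator S y) =
          (\<Sum>y\<in>S - {x}. D y * indicator S y * pmf (P (h n) x) y)"
        using S by (intro integral_measure_pmf_real) (auto simp: D_def indicator_def split: if_splits)
      also have "\<dots> = (\<Sum>y\<in>S - {x}. D y * pmf (P (h n) x) y)"
        by (intro sum.cong) auto
      finally have EP: "measure_pmf.expectation (P (h n) x) D =
          (\<Sum>y\<in>S - {x}. D y * pmf (P (h n) x) y) +
          measure_pmf.expectation (P (h n) x) (\<lambda>y. D y * indicator (-S) y)" .
      have "\<bar>measure_pmf.expectation (P (h n) x) (\<lambda>y. D y * indicator (-S) y)\<bar>
          \<le> measure_pmf.expectation (P (h n) x) (\<lambda>y. \<bar>D y * indicator (-S) y\<bar>)"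
        by (rule integral_abs_bound)
      also have "\<dots> \<le> measure_pmf.expectation (P (h n) x) (\<lambda>y. 2 * indicator (-S) y)"
        using D by (intro integral_mono integrable_measure_pmf_bounded[where B = 2])
           (auto simp: indicator_def)
      also have "\<dots> = 2 * (1 - measure (P (h n) x) S)"
        by (simp add: measure_pmf.prob_compl[of S, simplified] Compl_eq_Diff_UNIV)
      also have "measure (P (h n) x) S = pmf (P (h n) x) x + (\<Sum>y\<in>S - {x}. pmf (P (h n) x) y)"
        using S by (simp add: measure_measure_pmf_finite sum.remove)
      finally have rest: "\<bar>measure_pmf.expectation (P (h n) x) (\<lambda>y. D y * indicator (-S) y)\<bar> \<le>
        2 * (1 - pmf (P (h n) x) x - (\<Sum>y\<in>S - {x}. pmf (P (h n) x) y))"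
        by simp
      have "?g n x = (\<Sum>y\<in>S - {x}. D y * (pmf (P (h n) x) y / h n - c * pmf (K x) y)) +
        measure_pmf.expectation (P (h n) x) (\<lambda>y. D y * indicator (-S) y) / h n"
        unfolding diff D_def[symmetric] EK EP
        by (simp add: add_divide_distrib sum_divide_distrib sum_distrib_left algebra_simps sum_subtractf)
      moreover have "\<bar>\<Sum>y\<in>S - {x}. D y * (pmf (P (h n) x) y / h n - c * pmf (K x) y)\<bar> \<le>
        (\<Sum>y\<in>S - {x}. 2 * \<bar>pmf (P (h n) x) y / h n - c * pmf (K x) y\<bar>)"
        using D by (intro order_trans[OF sum_abs] sum_mono) (auto simp: abs_mult intro!: mult_right_mono)
      moreover have "\<bar>measure_pmf.expectation (P (h n) x) (\<lambda>y. D y * indicator (-S) y) / h n\<bar> \<le>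
        2 * ((1 - pmf (P (h n) x) x) / h n - (\<Sum>y\<in>S - {x}. pmf (P (h n) x) y / h n))"
        using divide_right_mono[OF rest, of "h n"] h(2)[of n]
        by (simp add: diff_divide_distrib flip: sum_divide_distrib)
      ultimately show ?thesis
        unfolding sum_distrib_left[symmetric] by linarith
    qed
    have jump': "(\<lambda>n. pmf (P (h n) x) y / h n) \<longlonglongrightarrow> c * pmf (K x) y" if "y \<in> S - {x}" for y
      using filterlim_compose[OF jump h(1)] that by auto
    have "(\<lambda>n. 2 * (\<Sum>y\<in>S - {x}. \<bar>pmf (P (h n) x) y / h n - c * pmf (K x) y\<bar>) +
      2 * ((1 - pmf (P (h n) x) x) / h n - (\<Sum>y\<in>S - {x}. pmf (P (h n) x) y / h n)))
      \<longlonglongrightarrow> 2 * (\<Sum>y\<in>S - {x}. \<bar>c * pmf (K x) y - c * pmf (K x) y\<bar>) +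
      2 * (c * (1 - pmf (K x) x) - (\<Sum>y\<in>S - {x}. c * pmf (K x) y))"
      by (intro tendsto_intros jump' filterlim_compose[OF leave h(1)])
    \<comment> \<open>\<open>K x\<close> is carried by \<open>S\<close>, so the limiting rates into
      \<open>S\<close> add up to the whole exit rate: the rate of jumps outside \<open>S\<close>
      tends to 0.\<close>
    also have "(\<Sum>y\<in>S - {x}. c * pmf (K x) y) = c * (1 - pmf (K x) x)"
      using S sum_pmf_eq_1[of S "K x"] unfolding sum_distrib_left[symmetric]
      by (subst sum_diff1) (auto simp: S_def)
    finally have "(\<lambda>n. 2 * (\<Sum>y\<in>S - {x}. \<bar>pmf (P (h n) x) y / h n - c * pmf (K x) y\<bar>) +
      2 * ((1 - pmf (P (h n) x) x) / h n - (\<Sum>y\<in>S - {x}. pmf (P (h n) x) y / h n))) \<longlonglongrightarrow> 0"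
      by simp
    then show ?thesis
      by (rule Lim_null_comparison[rotated]) (simp only: real_norm_def bound eventually_True)
  qed
  \<comment> \<open>Every exit rate is at most \<open>c\<close>, so the linear bound on exit
    probabilities makes the difference quotient at most \<open>2 * c\<close>; the kernel term
    contributes at most another \<open>2 * c\<close>.\<close>
  have dom: "\<bar>?g n x\<bar> \<le> 4 * c" for n x
  proof -
    have "1 - pmf (P (h n) x) x \<le> c * (1 - pmf (K x) x) * h n"
      using h(2)[of n] by (intro transition_function_leave_le[OF P _ leave]) simp
    also have "\<dots> \<le> c * h n"
      using c h(2)[of n] by (intro mult_right_mono) auto
    finally have "\<bar>measure_pmf.expectation (P (h n) x) (f n) - f n x\<bar> \<le> 2 * (c * h n)"
      by (intro order_trans[OF dev]) simp
    then have "\<bar>(measure_pmf.expectation (P (h n) x) (f n) - f n x) / h n\<bar> \<le> 2 * c"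
      using h(2)[of n] by (simp add: field_simps)
    moreover have "\<bar>c * (measure_pmf.expectation (K x) (f n) - f n x)\<bar> \<le> c * 2"
      using c unfolding abs_mult by (intro mult_mono order_trans[OF dev]) auto
    ultimately show ?thesis
      by linarith
  qed
  have "(\<lambda>n. measure_pmf.expectation p (?g n)) \<longlonglongrightarrow> measure_pmf.expectation p (\<lambda>x. 0)"
    by (rule integral_dominated_convergence[where w = "\<lambda>_. 4 * c"]) (use pointwise dom in auto)
  then show ?thesis
    by simp
qed

text \<open>Under \<open>p\<close> the expected difference between the two increments, one of
  \<open>P\<close> and one of \<open>K\<close>, tends to 0. Either kind of invariance makes one of
  them vanish, and the test functions are chosen so that the other does not depend on
  \<open>n\<close>, hence is 0.\<close>

theorem stationary_distribution_iff_uniformization: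
  assumes P: "transition_function P" and K: "has_uniformization P c K"
  shows "stationary_distribution P p \<longleftrightarrow> bind_pmf p K = p"
proof
  have c: "c > 0"
    using K by (simp add: has_uniformization_def)
  assume p: "stationary_distribution P p"
  show "bind_pmf p K = p"
  proof (rule pmf_eqI)
    fix y
    define h where "h n = 1 / real (Suc n)" for n
    have h: "filterlim h (at_right 0) sequentially" "0 < h n" for n
      unfolding h_def using filterlim_divide_Suc_at_right_0[of 1] by auto
    have E: "measure_pmf.expectation M (indicator {y}) = pmf M y" for M :: "'a pmf"
      by (simp add: measure_pmf_single)
    have int: "integrable (measure_pmf p) (\<lambda>x. pmf (N x) y)" for N :: "'a \<Rightarrow> 'a pmf"
      by (intro integrable_measure_pmf_bounded[where B = 1]) (simp add: pmf_le_1)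
    have int1: "integrable (measure_pmf p) (indicat_real {y})"
      by (intro integrable_measure_pmf_bounded[where B = 1]) simp
    \<comment> \<open>Stationarity cancels the part coming from \<open>P\<close>; the remainder is
      constant in \<open>n\<close>.\<close>
    have "measure_pmf.expectation p (\<lambda>x. (pmf (P (h n) x) y - indicator {y} x) / h n
             - c * (pmf (K x) y - indicator {y} x)) = - c * (pmf (bind_pmf p K) y - pmf p y)" for n
    proof -
      have "measure_pmf.expectation p (\<lambda>x. pmf (P (h n) x) y) = pmf p y"
        using p h(2)[of n] by (simp add: pmf_bind[symmetric] stationary_distribution_def)
      then show ?thesis
        by (subst Bochner_Integration.integral_diff)
          (auto intro!: integrable_divide_zero Bochner_Integration.integrable_diff int int1
            simp: Bochner_Integration.integral_diff int int1 E pmf_bind measure_pmf_single)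
    qed
    with expectation_tendsto_uniformized_generator[OF P K h, of "\<lambda>_. indicator {y}" p]
    have "(\<lambda>n. - c * (pmf (bind_pmf p K) y - pmf p y)) \<longlonglongrightarrow> 0"
      by (simp add: measure_pmf_single)
    then have "- c * (pmf (bind_pmf p K) y - pmf p y) = 0"
      by (simp only: LIMSEQ_const_iff)
    then show "pmf (bind_pmf p K) y = pmf p y"
      using c by simp
  qed
next
  assume p: "bind_pmf p K = p"
  show "stationary_distribution P p"
    unfolding stationary_distribution_def
  proof (intro allI impI)
    fix t :: real
    assume "t \<ge> 0"
    show "bind_pmf p (P t) = p"
    proof (cases "t = 0")
      case True
      then show ?thesis
        by (simp add: transition_functionD[OF P] bind_return_pmf')
    next
      case False
      with \<open>t \<ge> 0\<close> have t: "t > 0"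
        by simp
      define h where "h n = t / real (Suc n)" for n
      have pos: "0 < h n" for n
        using t by (simp add: h_def)
      have lim: "filterlim h (at_right 0) sequentially"
        unfolding h_def by (rule filterlim_divide_Suc_at_right_0[OF t])
      show ?thesis
      proof (rule pmf_eqI)
        fix y
        \<comment> \<open>By Chapman--Kolmogorov, each increment of the probability of y on the grid of mesh h is an
          increment from time 0 to h of the expectation of some test function; their sum only
          involves the average f of these test functions.\<close>
        define f where "f n x = (\<Sum>j<Suc n. pmf (P (real j * h n) x) y) / real (Suc n)" for n x
        have f0: "0 \<le> f n x" for n x
          unfolding f_def by (intro divide_nonneg_nonneg sum_nonneg) auto
        have f1: "f n x \<le> 1" for n x
        proof -
          have "(\<Sum>j<Suc n. pmf (P (real j * h n) x) y) \<le> (\<Sum>j<Suc n. 1)"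
            by (intro sum_mono pmf_le_1)
          then show ?thesis
            by (simp add: f_def)
        qed
        have f: "\<bar>f n x\<bar> \<le> 1" for n x
          using f0 f1 by simp
        have int: "integrable (measure_pmf M) (\<lambda>x. pmf (N x) y)" for N :: "'a \<Rightarrow> 'a pmf" and M
          by (intro integrable_measure_pmf_bounded[where B = 1]) (simp add: pmf_le_1)
        have int_f: "integrable (measure_pmf M) (f n)" for M n
          by (rule integrable_measure_pmf_bounded[OF f])
        have E1: "\<bar>measure_pmf.expectation M (f n)\<bar> \<le> 1" for M n
        proof -
          have "measure_pmf.expectation M (f n) \<le> measure_pmf.expectation M (\<lambda>_. 1)"
            using f1 by (intro integral_mono int_f) auto
          moreover have "0 \<le> measure_pmf.expectation M (f n)"
            using f0 by simp
          ultimately show ?thesis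
            by simp
        qed
        have int_Ef: "integrable (measure_pmf p) (\<lambda>x. measure_pmf.expectation (N x) (f n))"
          for N :: "'a \<Rightarrow> 'a pmf" and n
          by (rule integrable_measure_pmf_bounded[OF E1])
        have step: "measure_pmf.expectation (P (h n) x) (f n) - f n x =
            (pmf (P t x) y - pmf (P 0 x) y) / real (Suc n)" for n x
        proof -
          have "measure_pmf.expectation (P (h n) x) (f n) =
              (\<Sum>j<Suc n. measure_pmf.expectation (P (h n) x) (\<lambda>z. pmf (P (real j * h n) z) y)) / real (Suc n)"
            unfolding f_def by (simp only: integral_divide_zero) (subst Bochner_Integration.integral_sum, auto simp: int)
          also have "\<dots> = (\<Sum>j<Suc n. pmf (P (real (Suc j) * h n) x) y) / real (Suc n)"
          proof -
            have "P (real (Suc j) * h n) x = bind_pmf (P (h n) x) (P (real j * h n))" for j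
              using pos[of n] by (subst transition_functionD(2)[OF P, symmetric]) (auto simp: algebra_simps)
            then show ?thesis
              by (simp only: pmf_bind)
          qed
          finally have "measure_pmf.expectation (P (h n) x) (f n) - f n x =
             ((\<Sum>j<Suc n. pmf (P (real (Suc j) * h n) x) y - pmf (P (real j * h n) x) y)) / real (Suc n)"
            by (simp only: f_def diff_divide_distrib sum_subtractf)
          also have "(\<Sum>j<Suc n. pmf (P (real (Suc j) * h n) x) y - pmf (P (real j * h n) x) y) =
              pmf (P (real (Suc n) * h n) x) y - pmf (P (real 0 * h n) x) y"
            by (rule sum_lessThan_telescope)
          finally show ?thesis
            by (simp add: h_def)
        qed
        \<comment> \<open>Invariance under \<open>K\<close> cancels the kernel part. Since
          \<open>real (Suc n) * h n = t\<close>, the telescoped increment divided by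
          \<open>h n\<close> is a quotient over the whole interval \<open>[0, t]\<close>, the same
          for all \<open>n\<close>.\<close>
        have "measure_pmf.expectation p (\<lambda>x.
           (measure_pmf.expectation (P (h n) x) (f n) - f n x) / h n
             - c * (measure_pmf.expectation (K x) (f n) - f n x)) =
           (pmf (bind_pmf p (P t)) y - pmf p y) / t" for n
        proof -
          have "measure_pmf.expectation p (\<lambda>x. measure_pmf.expectation (K x) (f n) - f n x) =
            measure_pmf.expectation (bind_pmf p K) (f n) - measure_pmf.expectation p (f n)"
            by (subst Bochner_Integration.integral_diff)
              (auto simp: int_f int_Ef expectation_bind_pmf[OF f0 f1])
          then have K0: "measure_pmf.expectation p (\<lambda>x. measure_pmf.expectation (K x) (f n) - f n x) = 0"
            by (simp add: p)
          have "(measure_pmf.expectation (P (h n) x) (f n) - f n x) / h n =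
              (pmf (P t x) y - pmf (P 0 x) y) / t" for x
            unfolding step by (simp add: h_def del: of_nat_Suc)
          then have "measure_pmf.expectation p (\<lambda>x. (measure_pmf.expectation (P (h n) x) (f n) - f n x) / h n) =
              (pmf (bind_pmf p (P t)) y - pmf (bind_pmf p (P 0)) y) / t"
            by (simp add: pmf_bind Bochner_Integration.integral_diff int)
          also have "bind_pmf p (P 0) = p"
            using transition_functionD(1)[OF P] by (simp add: bind_return_pmf')
          finally show ?thesis
            using K0 by (subst Bochner_Integration.integral_diff)
             (auto intro!: integrable_divide_zero Bochner_Integration.integrable_diff int_f int_Ef)
        qed
        with expectation_tendsto_uniformized_generator[OF P K lim pos, of f p, OF f]
        have "(\<lambda>n. (pmf (bind_pmf p (P t)) y - pmf p y) / t) \<longlonglongrightarrow> 0"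
          by simp
        then show "pmf (bind_pmf p (P t)) y = pmf p y"
          using t by (simp add: LIMSEQ_const_iff)
      qed
    qed
  qed
qed

section \<open>Existence of an invariant law\<close>

text \<open>The invariant law is that of the chain with kernel N, started in a and observed at a
  geometric time.\<close>
lemma resetting_kernel_has_invariant_pmf:
  assumes e: "0 < e" "e \<le> 1"
  shows "\<exists>p. bind_pmf p (\<lambda>x. bernoulli_pmf e \<bind> (\<lambda>b. if b then return_pmf a else N x)) = p"
proof -
  define X where "X n = ((\<lambda>M. bind_pmf M N) ^^ n) (return_pmf a)" for n
  define p where "p = bind_pmf (geometric_pmf e) X"
  have "bind_pmf p (\<lambda>x. bernoulli_pmf e \<bind> (\<lambda>b. if b then return_pmf a else N x)) =
      bernoulli_pmf e \<bind> (\<lambda>b. if b then return_pmf a else bind_pmf p N)"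
    by (subst bind_commute_pmf) (auto intro!: bind_pmf_cong)
  also have "bind_pmf p N = bind_pmf (map_pmf Suc (geometric_pmf e)) X"
    by (simp add: p_def bind_assoc_pmf bind_map_pmf X_def)
  \<comment> \<open>A geometric time is 0 with probability \<open>e\<close> and otherwise one more
    than another geometric time.\<close>
  also have "bernoulli_pmf e \<bind>
      (\<lambda>b. if b then return_pmf a else bind_pmf (map_pmf Suc (geometric_pmf e)) X) = p"
    unfolding p_def
    by (subst (2) geometric_bind_pmf_unfold)
      (use e in \<open>auto simp: bind_assoc_pmf bind_return_pmf X_def intro!: bind_pmf_cong\<close>)
  finally show ?thesis
    by blast
qed

section \<open>The jump kernel of the queue and its balance equations\<close>

lemma has_transition_rates_cong:
  assumes "\<And>x y. x \<noteq> y \<Longrightarrow> q x y = q' x y"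
  shows "has_transition_rates P q \<longleftrightarrow> has_transition_rates P q'"
proof -
  have "(\<Sum>\<^sub>\<infinity>y\<in>-{x}. q x y) = (\<Sum>\<^sub>\<infinity>y\<in>-{x}. q' x y)" for x
    using assms by (intro infsum_cong) auto
  then show ?thesis
    using assms by (simp add: has_transition_rates_def)
qed

text \<open>The queue without resetting, uniformized at rate \<open>lam + real r * \<mu>\<close>:
  all \<open>r\<close> servers ring at rate \<open>\<mu>\<close>, and a ring counts as a departure
  only if it comes from a busy server. In the empty state that probability is 0.\<close>

definition mmr_step :: "nat \<Rightarrow> real \<Rightarrow> real \<Rightarrow> nat \<Rightarrow> nat pmf" where
  "mmr_step r lam \<mu> x =
     bernoulli_pmf (lam / (lam + real r * \<mu>)) \<bind> (\<lambda>b. if b then return_pmf (x + 1)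
       else bernoulli_pmf (real (min x r) / real r) \<bind> (\<lambda>d. return_pmf (if d then x - 1 else x)))"

text \<open>The reset is drawn first and independently of the state, the form in which the existence
  of an invariant law was proved. It also fires in state 0, where it changes nothing.\<close>

definition mmr_reset_step :: "nat \<Rightarrow> real \<Rightarrow> real \<Rightarrow> real \<Rightarrow> nat \<Rightarrow> nat pmf" where
  "mmr_reset_step r lam \<mu> \<kappa> x =
     bernoulli_pmf (\<kappa> / (lam + real r * \<mu> + \<kappa>)) \<bind>
       (\<lambda>b. if b then return_pmf 0 else mmr_step r lam \<mu> x)"

lemma pmf_mmr_step:
  assumes "r \<ge> 1" "lam > 0" "\<mu> > 0"
  shows "(lam + real r * \<mu>) * pmf (mmr_step r lam \<mu> x) y =
     lam * indicator {x + 1} y + real (min x r) * \<mu> * indicator {x - 1} y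
     + (real r - real (min x r)) * \<mu> * indicator {x} y"
proof -
  define s where "s = lam + real r * \<mu>"
  have s: "s > 0" "lam \<le> s"
    using assms by (auto simp: s_def add_pos_nonneg)
  have r: "real r > 0"
    using assms by simp
  define q where "q = real (min x r) / real r"
  have q: "real (min x r) = real r * q" "0 \<le> q" "q \<le> 1"
    using r by (auto simp: q_def)
  have "pmf (mmr_step r lam \<mu> x) y = indicator {x + 1} y * (lam / s) +
    (indicator {x - 1} y * q + indicator {x} y * (1 - q)) * (1 - lam / s)"
    unfolding mmr_step_def s_def[symmetric] q_def[symmetric] using s q(2,3) assms
    by (simp add: pmf_bind indicator_def)
  also have "1 - lam / s = real r * \<mu> / s"
    using s by (simp add: s_def field_simps)
  finally show ?thesis
    unfolding s_def[symmetric] q(1) using s by (simp add: field_simps)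
qed

lemma pmf_mmr_reset_step:
  assumes "r \<ge> 1" "lam > 0" "\<mu> > 0" "\<kappa> > 0"
  shows "(lam + real r * \<mu> + \<kappa>) * pmf (mmr_reset_step r lam \<mu> \<kappa> x) y =
     \<kappa> * indicator {0} y + lam * indicator {x + 1} y + real (min x r) * \<mu> * indicator {x - 1} y
     + (real r - real (min x r)) * \<mu> * indicator {x} y"
proof -
  define s where "s = lam + real r * \<mu>"
  have s: "s > 0"
    using assms by (auto simp: s_def add_pos_nonneg)
  have "pmf (mmr_reset_step r lam \<mu> \<kappa> x) y =
    indicator {0} y * (\<kappa> / (s + \<kappa>)) + pmf (mmr_step r lam \<mu> x) y * (1 - \<kappa> / (s + \<kappa>))"
    unfolding mmr_reset_step_def s_def[symmetric] using s assms
    by (simp add: pmf_bind indicator_def)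
  also have "1 - \<kappa> / (s + \<kappa>) = s / (s + \<kappa>)"
    using s assms by (simp add: field_simps)
  finally have "(s + \<kappa>) * pmf (mmr_reset_step r lam \<mu> \<kappa> x) y =
    \<kappa> * indicator {0} y + s * pmf (mmr_step r lam \<mu> x) y"
    using s assms by (simp add: add_divide_distrib[symmetric])
  then show ?thesis
    unfolding s_def pmf_mmr_step[OF assms(1-3)] by simp
qed

text \<open>Kernel and rates differ only on the diagonal, where idle servers and the reset of the
  empty queue produce jumps from a state to itself.\<close>

lemma mmr_reset_queue_uniformization:
  assumes pos: "r \<ge> 1" "lam > 0" "\<mu> > 0" "\<kappa> > 0"
    and P: "mmr_reset_queue r lam \<mu> \<kappa> P"
  shows "has_uniformization P (lam + real r * \<mu> + \<kappa>) (mmr_reset_step r lam \<mu> \<kappa>)"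
  unfolding has_uniformization_def
proof (intro conjI allI)
  have "mmr_reset_rate r lam \<mu> \<kappa> x y =
    (lam + real r * \<mu> + \<kappa>) * pmf (mmr_reset_step r lam \<mu> \<kappa> x) y" if "x \<noteq> y" for x y
    unfolding pmf_mmr_reset_step[OF pos] mmr_reset_rate_def using that by auto
  then show "has_transition_rates P
      (\<lambda>x y. (lam + real r * \<mu> + \<kappa>) * pmf (mmr_reset_step r lam \<mu> \<kappa> x) y)"
    using P has_transition_rates_cong[of "mmr_reset_rate r lam \<mu> \<kappa>"]
    by (auto simp: mmr_reset_queue_def)
  show "lam + real r * \<mu> + \<kappa> > 0"
    using pos by (simp add: add_pos_nonneg)
  show "finite (set_pmf (mmr_reset_step r lam \<mu> \<kappa> x))" for x
    by (auto simp: mmr_reset_step_def mmr_step_def)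
qed

text \<open>Resets lead to 0 from every state, 0 included, so their total inflow is
  \<open>\<kappa>\<close> times the mass 1 of \<open>p\<close>; this is the source term at
  \<open>y = 0\<close>. The self-jumps of idle servers cancel from both sides.\<close>

lemma mmr_reset_step_balance:
  assumes pos: "r \<ge> 1" "lam > 0" "\<mu> > 0" "\<kappa> > 0"
    and p: "bind_pmf p (mmr_reset_step r lam \<mu> \<kappa>) = p"
  shows "(lam + real (min y r) * \<mu> + \<kappa>) * pmf p y =
     (if y = 0 then \<kappa> else lam * pmf p (y - 1)) + real (min (y + 1) r) * \<mu> * pmf p (y + 1)"
proof -
  let ?c = "lam + real r * \<mu> + \<kappa>"
  have int: "integrable (measure_pmf p) (indicat_real X)" for X
    by (intro integrable_measure_pmf_bounded[where B = 1]) (simp add: indicator_def)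
  have "?c * pmf p y = ?c * pmf (bind_pmf p (mmr_reset_step r lam \<mu> \<kappa>)) y"
    by (simp add: p)
  also have "\<dots> = measure_pmf.expectation p (\<lambda>x. ?c * pmf (mmr_reset_step r lam \<mu> \<kappa> x) y)"
    by (simp add: pmf_bind)
  also have "\<dots> = measure_pmf.expectation p (\<lambda>x. (if y = 0 then \<kappa> else lam * indicator {y - 1} x)
      + real (min (y + 1) r) * \<mu> * indicator {y + 1} x
      + (real r - real (min y r)) * \<mu> * indicator {y} x)"
    unfolding pmf_mmr_reset_step[OF pos]
    by (intro Bochner_Integration.integral_cong) (auto simp: indicator_def)
  also have "\<dots> = (if y = 0 then \<kappa> else lam * pmf p (y - 1))
      + real (min (y + 1) r) * \<mu> * pmf p (y + 1) + (real r - real (min y r)) * \<mu> * pmf p y"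
    by (cases "y = 0") (simp_all add: Bochner_Integration.integral_add int measure_pmf_single)
  finally show ?thesis
    by (simp add: algebra_simps)
qed

section \<open>Recurrences for the coefficients A and C\<close>

text \<open>The possibly unbounded factor is nonnegative with antiderivative
  \<open>- ((1 - s) powr \<gamma>)\<close>, continuous up to 1, hence absolutely integrable. The
  remaining factor is continuous and bounded.\<close>

lemma A_coeff_integrable:
  fixes \<theta> \<gamma> :: real
  assumes "\<gamma> > 0"
  shows "(\<lambda>s. \<gamma> * (1 - s) powr (\<gamma> - 1) * s ^ n * exp (- \<theta> * s)) integrable_on {0..1}"
proof -
  have "((\<lambda>s::real. \<gamma> * (1 - s) powr (\<gamma> - 1)) has_integral
      - ((1 - 1) powr \<gamma>) - - ((1 - 0) powr \<gamma>)) {0..1}"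
  proof (rule fundamental_theorem_of_calculus_interior)
    show "continuous_on {0..1} (\<lambda>s. - ((1 - s) powr \<gamma>))"
      using assms by (intro continuous_on_minus continuous_on_powr' continuous_on_diff
          continuous_on_const continuous_on_id) auto
    show "((\<lambda>s. - ((1 - s) powr \<gamma>)) has_vector_derivative \<gamma> * (1 - s) powr (\<gamma> - 1)) (at s)"
      if "s \<in> {0<..<1}" for s
      unfolding has_real_derivative_iff_has_vector_derivative[symmetric]
      using that by (auto intro!: derivative_eq_intros)
  qed simp
  then have "(\<lambda>s. \<gamma> * (1 - s) powr (\<gamma> - 1)) absolutely_integrable_on {0..1}"
    using assms by (intro nonnegative_absolutely_integrable_1) (auto simp: integrable_on_def)
  moreover have cont: "continuous_on {0..1} (\<lambda>s. s ^ n * exp (- \<theta> * s))"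
    by (intro continuous_intros)
  moreover have "bounded ((\<lambda>s. s ^ n * exp (- \<theta> * s)) ` {0..1})"
    by (intro compact_imp_bounded compact_continuous_image cont) simp
  ultimately have "(\<lambda>s. s ^ n * exp (- \<theta> * s) * (\<gamma> * (1 - s) powr (\<gamma> - 1)))
      absolutely_integrable_on {0..1}"
    by (intro absolutely_integrable_bounded_measurable_product_real
          [where f = "\<lambda>s. s ^ n * exp (- \<theta> * s)"]
        continuous_imp_measurable_on_sets_lebesgue) simp_all
  then have "(\<lambda>s. s ^ n * exp (- \<theta> * s) * (\<gamma> * (1 - s) powr (\<gamma> - 1))) integrable_on {0..1}"
    by (rule set_lebesgue_integral_eq_integral(1))
  then show ?thesis
    by (simp add: mult_ac)
qed

text \<open>Integrate the derivative of \<open>\<gamma> * (1 - s) powr \<gamma> * s ^ k * exp (-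
  \<theta> * s)\<close> over \<open>[0, 1]\<close>. Writing \<open>(1 - s) powr \<gamma>\<close> as
  \<open>(1 - s) * (1 - s) powr (\<gamma> - 1)\<close> expresses it through the integrands for
  \<open>k - 1\<close>, \<open>k\<close> and \<open>k + 1\<close>. The boundary term is 0 at 1, and
  at 0 it survives only for \<open>k = 0\<close>.\<close>

lemma A_coeff_rec:
  assumes \<gamma>: "\<gamma> > 0"
  shows "\<theta> * A_coeff \<theta> \<gamma> (Suc k) =
    (\<theta> + real k + \<gamma>) * A_coeff \<theta> \<gamma> k - real k * A_coeff \<theta> \<gamma> (k - 1) - (if k = 0 then \<gamma> else 0)"
proof -
  define w where "w n s = \<gamma> * (1 - s) powr (\<gamma> - 1) * s ^ n * exp (- \<theta> * s)" for n and s :: real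
  have A: "(w n has_integral A_coeff \<theta> \<gamma> n) {0..1}" for n
    unfolding w_def A_coeff_def by (intro integrable_integral A_coeff_integrable[OF \<gamma>])
  define F where "F s = \<gamma> * (1 - s) powr \<gamma> * s ^ k * exp (- \<theta> * s)" for s :: real
  have "((\<lambda>s. \<theta> * w (Suc k) s - (\<theta> + real k + \<gamma>) * w k s + real k * w (k - 1) s) has_integral
      F 1 - F 0) {0..1}"
  proof (rule fundamental_theorem_of_calculus_interior)
    show "continuous_on {0..1} F"
      unfolding F_def using \<gamma>
      by (intro continuous_on_mult continuous_on_powr' continuous_on_power continuous_on_exp
          continuous_on_diff continuous_on_const continuous_on_id) auto
    fix s :: real
    assume s: "s \<in> {0<..<1}"
    have pw: "(1 - s) powr \<gamma> = (1 - s) * (1 - s) powr (\<gamma> - 1)"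
      using s powr_add[of "1 - s" 1 "\<gamma> - 1"] by simp
    have powr: "((\<lambda>s. (1 - s) powr \<gamma>) has_real_derivative - \<gamma> * (1 - s) powr (\<gamma> - 1)) (at s)"
      using s by (auto intro!: derivative_eq_intros)
    have power: "((\<lambda>s. s ^ k) has_real_derivative real k * s ^ (k - 1)) (at s)"
      by (auto intro!: derivative_eq_intros)
    have exp: "((\<lambda>s. exp (- \<theta> * s)) has_real_derivative - \<theta> * exp (- \<theta> * s)) (at s)"
      by (auto intro!: derivative_eq_intros)
    have "(F has_real_derivative
        \<theta> * w (Suc k) s - (\<theta> + real k + \<gamma>) * w k s + real k * w (k - 1) s) (at s)"
      unfolding F_def
      by (rule DERIV_cong[OF DERIV_mult[OF DERIV_mult[OF DERIV_cmult[OF powr] power] exp]])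
        (cases k; simp add: w_def pw algebra_simps)
    then show "(F has_vector_derivative
        \<theta> * w (Suc k) s - (\<theta> + real k + \<gamma>) * w k s + real k * w (k - 1) s) (at s)"
      by (simp add: has_real_derivative_iff_has_vector_derivative)
  qed simp
  moreover have "((\<lambda>s. \<theta> * w (Suc k) s - (\<theta> + real k + \<gamma>) * w k s + real k * w (k - 1) s) has_integral
      \<theta> * A_coeff \<theta> \<gamma> (Suc k) - (\<theta> + real k + \<gamma>) * A_coeff \<theta> \<gamma> k + real k * A_coeff \<theta> \<gamma> (k - 1)) {0..1}"
    by (intro has_integral_add has_integral_diff has_integral_mult_right A)
  ultimately have "\<theta> * A_coeff \<theta> \<gamma> (Suc k) - (\<theta> + real k + \<gamma>) * A_coeff \<theta> \<gamma> k
      + real k * A_coeff \<theta> \<gamma> (k - 1) = F 1 - F 0"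
    by (rule has_integral_unique[rotated])
  also have "F 1 - F 0 = - (if k = 0 then \<gamma> else 0)"
    by (simp add: F_def)
  finally show ?thesis
    by simp
qed

text \<open>Pascal's rule, after splitting off the term \<open>l = 0\<close>. Both the recurrence
  and the monotonicity of C follow from this form.\<close>

lemma C_coeff_diff:
  "C_coeff \<theta> \<gamma> (Suc k) - C_coeff \<theta> \<gamma> k =
     (\<Sum>l\<le>k. real (k choose l) * pochhammer \<gamma> (Suc l) / \<theta> ^ Suc l)"
proof -
  have "C_coeff \<theta> \<gamma> (Suc k) =
    1 + (\<Sum>l\<le>k. real (Suc k choose Suc l) * pochhammer \<gamma> (Suc l) / \<theta> ^ Suc l)"
    unfolding C_coeff_def by (subst sum.atMost_Suc_shift) simp
  also have "(\<Sum>l\<le>k. real (Suc k choose Suc l) * pochhammer \<gamma> (Suc l) / \<theta> ^ Suc l) =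
    (\<Sum>l\<le>k. real (k choose l) * pochhammer \<gamma> (Suc l) / \<theta> ^ Suc l) +
    (\<Sum>l\<le>k. real (k choose Suc l) * pochhammer \<gamma> (Suc l) / \<theta> ^ Suc l)"
    by (simp only: sum.distrib[symmetric] binomial_Suc_Suc of_nat_add distrib_right add_divide_distrib)
  also have "1 + (X + (\<Sum>l\<le>k. real (k choose Suc l) * pochhammer \<gamma> (Suc l) / \<theta> ^ Suc l)) =
    X + (\<Sum>l\<le>Suc k. real (k choose l) * pochhammer \<gamma> l / \<theta> ^ l)" for X
    by (subst sum.atMost_Suc_shift) simp
  finally show ?thesis
    by (simp add: C_coeff_def)
qed

text \<open>In the difference formula \<open>pochhammer \<gamma> (Suc l)\<close> releases a factor
  \<open>\<gamma> + real l\<close>. The part with \<open>\<gamma>\<close> is C itself; in the part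
  with \<open>l\<close>, the absorption identity for binomials recreates a difference, one index
  lower.\<close>

lemma C_coeff_rec:
  assumes \<theta>: "\<theta> > 0"
  shows "\<theta> * C_coeff \<theta> \<gamma> (Suc k) =
    (\<theta> + real k + \<gamma>) * C_coeff \<theta> \<gamma> k - real k * C_coeff \<theta> \<gamma> (k - 1)"
proof -
  have "\<theta> * (C_coeff \<theta> \<gamma> (Suc k) - C_coeff \<theta> \<gamma> k) =
    (\<Sum>l\<le>k. real (k choose l) * (\<gamma> + real l) * pochhammer \<gamma> l / \<theta> ^ l)"
    unfolding C_coeff_diff sum_distrib_left using \<theta>
    by (intro sum.cong) (auto simp: pochhammer_Suc field_simps)
  also have "\<dots> = \<gamma> * C_coeff \<theta> \<gamma> k + (\<Sum>l\<le>k. real l * real (k choose l) * pochhammer \<gamma> l / \<theta> ^ l)"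
    unfolding C_coeff_def sum_distrib_left sum.distrib[symmetric]
    by (intro sum.cong) (auto simp: algebra_simps add_divide_distrib)
  also have "(\<Sum>l\<le>k. real l * real (k choose l) * pochhammer \<gamma> l / \<theta> ^ l) =
    real k * (C_coeff \<theta> \<gamma> k - C_coeff \<theta> \<gamma> (k - 1))"
  proof (cases k)
    case (Suc m)
    have "real (Suc l) * real (Suc m choose Suc l) = real (Suc m) * real (m choose l)" for l
      using Suc_times_binomial[of l m] by (metis of_nat_mult)
    then show ?thesis
      unfolding Suc diff_Suc_1 C_coeff_diff
      by (subst sum.atMost_Suc_shift) (simp add: sum_distrib_left mult.assoc)
  qed simp
  finally show ?thesis
    by (simp add: algebra_simps)
qed

lemma C_coeff_pos_mono:
  assumes "\<theta> > 0" "\<gamma> > 0"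
  shows "C_coeff \<theta> \<gamma> k > 0" and "C_coeff \<theta> \<gamma> k \<le> C_coeff \<theta> \<gamma> (Suc k)"
proof -
  show mono: "C_coeff \<theta> \<gamma> k \<le> C_coeff \<theta> \<gamma> (Suc k)" for k
  proof -
    have "0 \<le> (\<Sum>l\<le>k. real (k choose l) * pochhammer \<gamma> (Suc l) / \<theta> ^ Suc l)"
      using assms by (intro sum_nonneg divide_nonneg_nonneg mult_nonneg_nonneg)
        (auto intro: less_imp_le pochhammer_pos)
    then show ?thesis
      using C_coeff_diff[of \<theta> \<gamma> k] by simp
  qed
  have "C_coeff \<theta> \<gamma> 0 \<le> C_coeff \<theta> \<gamma> k"
    by (rule lift_Suc_mono_le[of "C_coeff \<theta> \<gamma>", OF mono]) simp
  then show "C_coeff \<theta> \<gamma> k > 0"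
    by (simp add: C_coeff_def)
qed

section \<open>Bounded solutions of the balance equations\<close>

lemma bounded_geometric_imp_zero:
  fixes d :: "nat \<Rightarrow> real"
  assumes b: "b > 1" and d: "\<And>n. d (Suc n) = b * d n" and B: "\<And>n. \<bar>d n\<bar> \<le> B"
  shows "d n = 0"
proof -
  have dn: "d n = b ^ n * d 0" for n
    by (induction n) (auto simp: d)
  have "d 0 = 0"
  proof (rule ccontr)
    assume "d 0 \<noteq> 0"
    obtain n where "B / \<bar>d 0\<bar> < b ^ n"
      using real_arch_pow[OF b] by blast
    then have "B < \<bar>d n\<bar>"
      using \<open>d 0 \<noteq> 0\<close> b by (simp add: dn[of n] abs_mult divide_less_eq)
    then show False
      using B[of n] by simp
  qed
  then show ?thesis
    by (simp add: dn[of n])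
qed

text \<open>The roots of the characteristic polynomial are \<open>\<alpha>\<close> and
  \<open>b\<close>. The combination \<open>x (Suc n) - \<alpha> * x n\<close> removes the first root
  and is multiplied by \<open>b > 1\<close> at each step, so boundedness forces it to be 0.\<close>

lemma bounded_linear_recurrence:
  fixes x :: "nat \<Rightarrow> real"
  assumes a: "a \<noteq> 0" and b: "b > 1"
    and x: "\<And>n. a * x (Suc (Suc n)) = a * (\<alpha> + b) * x (Suc n) - a * \<alpha> * b * x n"
    and B: "\<And>n. \<bar>x n\<bar> \<le> B"
  shows "x n = \<alpha> ^ n * x 0"
proof -
  have "x (Suc n) - \<alpha> * x n = 0" for n
  proof (rule bounded_geometric_imp_zero[where d = "\<lambda>n. x (Suc n) - \<alpha> * x n", OF b])
    fix n
    have "a * (x (Suc (Suc n)) - \<alpha> * x (Suc n)) = a * (b * (x (Suc n) - \<alpha> * x n))"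
      using x[of n] by (simp add: algebra_simps)
    then show "x (Suc (Suc n)) - \<alpha> * x (Suc n) = b * (x (Suc n) - \<alpha> * x n)"
      using a by simp
    have "\<bar>x (Suc n) - \<alpha> * x n\<bar> \<le> \<bar>x (Suc n)\<bar> + \<bar>\<alpha>\<bar> * \<bar>x n\<bar>"
      by (metis abs_mult abs_triangle_ineq4)
    also have "\<dots> \<le> B + \<bar>\<alpha>\<bar> * B"
      using B by (intro add_mono mult_left_mono) auto
    finally show "\<bar>x (Suc n) - \<alpha> * x n\<bar> \<le> B + \<bar>\<alpha>\<bar> * B" .
  qed
  then have step: "x (Suc n) = \<alpha> * x n" for n
    by simp
  show ?thesis
    by (induction n) (auto simp: step)
qed

text \<open>Subtracting A removes the source term. At \<open>k = 0\<close> the coefficient of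
  \<open>u (k - 1)\<close> vanishes, so a homogeneous solution is determined by its value at 0;
  since C is 1 there, it is that value times C.\<close>

lemma recurrence_solution:
  fixes u :: "nat \<Rightarrow> real"
  assumes \<theta>: "\<theta> > 0" and \<gamma>: "\<gamma> > 0"
    and u: "\<And>k. k < r \<Longrightarrow>
      \<theta> * u (Suc k) = (\<theta> + real k + \<gamma>) * u k - real k * u (k - 1) - (if k = 0 then \<gamma> else 0)"
    and "k \<le> r"
  shows "u k = A_coeff \<theta> \<gamma> k + (u 0 - A_coeff \<theta> \<gamma> 0) * C_coeff \<theta> \<gamma> k"
proof -
  define v where "v k = u k - A_coeff \<theta> \<gamma> k - (u 0 - A_coeff \<theta> \<gamma> 0) * C_coeff \<theta> \<gamma> k" for k
  have v: "\<theta> * v (Suc k) = (\<theta> + real k + \<gamma>) * v k - real k * v (k - 1)" if "k < r" for k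
  proof -
    have "\<theta> * v (Suc k) = \<theta> * u (Suc k) - \<theta> * A_coeff \<theta> \<gamma> (Suc k)
        - (u 0 - A_coeff \<theta> \<gamma> 0) * (\<theta> * C_coeff \<theta> \<gamma> (Suc k))"
      by (simp add: v_def algebra_simps)
    then show ?thesis
      unfolding u[OF that] A_coeff_rec[OF \<gamma>] C_coeff_rec[OF \<theta>]
      by (simp add: v_def algebra_simps)
  qed
  have "v k = 0"
    using \<open>k \<le> r\<close>
  proof (induction k rule: less_induct)
    case (less k)
    show ?case
    proof (cases k)
      case 0
      then show ?thesis
        by (simp add: v_def C_coeff_def)
    next
      case (Suc m)
      then show ?thesis
        using v[of m] less.IH[of m] less.IH[of "m - 1"] less.prems \<theta> by simp
    qed
  qed
  then show ?thesis
    by (simp add: v_def)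
qed

lemma balance_solution:
  fixes p :: "nat \<Rightarrow> real"
  assumes r: "r \<ge> 1" and \<theta>: "\<theta> > 0" and \<gamma>: "\<gamma> > 0"
    and \<alpha>: "\<alpha> = (real r + \<theta> + \<gamma> - sqrt ((real r + \<theta> + \<gamma>)\<^sup>2 - 4 * \<theta> * real r)) / (2 * real r)"
    and L: "L = (\<theta> * A_coeff \<theta> \<gamma> r - real r * \<alpha> * A_coeff \<theta> \<gamma> (r - 1)) /
      (\<theta> * C_coeff \<theta> \<gamma> r - real r * \<alpha> * C_coeff \<theta> \<gamma> (r - 1))"
    and balance: "\<And>y. (\<theta> + real (min y r) + \<gamma>) * p y =
      (if y = 0 then \<gamma> else \<theta> * p (y - 1)) + real (min (y + 1) r) * p (y + 1)"
    and B: "\<And>k. \<bar>p k\<bar> \<le> B"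
  shows "k < r \<Longrightarrow> p k = \<theta> ^ k / fact k * (A_coeff \<theta> \<gamma> k - L * C_coeff \<theta> \<gamma> k)"
    and "k \<ge> r \<Longrightarrow> p k = \<alpha> ^ (k - r + 1) * p (r - 1)"
proof -
  define S where "S = real r + \<theta> + \<gamma>"
  define D where "D = sqrt (S\<^sup>2 - 4 * \<theta> * real r)"
  \<comment> \<open>The other root, next to \<open>\<alpha>\<close>, of
    \<open>real r * z\<^sup>2 - S * z + \<theta>\<close>, the characteristic polynomial of the
    balance equations from \<open>r\<close> on.\<close>
  define b where "b = (S + D) / (2 * real r)"
  have r0: "real r > 0"
    using r by simp
  \<comment> \<open>This form shows that the roots are real and that \<open>D\<close> exceeds
    \<open>real r - \<theta> - \<gamma>\<close>, which is \<open>b > 1\<close>.\<close>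
  have disc: "S\<^sup>2 - 4 * \<theta> * real r = (real r - \<theta> - \<gamma>)\<^sup>2 + 4 * real r * \<gamma>"
    by (simp add: S_def power2_eq_square algebra_simps)
  have D2: "D\<^sup>2 = S\<^sup>2 - 4 * \<theta> * real r"
    unfolding D_def disc using r0 \<gamma> by (intro real_sqrt_pow2) (auto intro: add_nonneg_nonneg)
  have "\<bar>real r - \<theta> - \<gamma>\<bar> < D"
    unfolding D_def disc using r0 \<gamma> by (intro real_less_rsqrt) auto
  then have b1: "b > 1"
    using r0 by (simp add: b_def S_def field_simps)
  have \<alpha>_eq: "\<alpha> = (S - D) / (2 * real r)"
    by (simp add: \<alpha> S_def D_def)
  have sum: "real r * (\<alpha> + b) = S"
    using r0 by (simp add: \<alpha>_eq b_def field_simps)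
  have "real r * \<alpha> * b = (S - D) * (S + D) / (4 * real r)"
    using r0 by (simp add: \<alpha>_eq b_def)
  also have "(S - D) * (S + D) = \<theta> * (4 * real r)"
    using D2 by (simp add: power2_eq_square algebra_simps)
  finally have prod: "real r * \<alpha> * b = \<theta>"
    using r0 by simp
  \<comment> \<open>The geometric form starts already at \<open>r - 1\<close>: balance at
    \<open>r\<close> has all its service rates equal to those of \<open>r\<close> servers and
    reaches back to \<open>p (r - 1)\<close>.\<close>
  have tail: "p (r - 1 + n) = \<alpha> ^ n * p (r - 1)" for n
  proof -
    have "real r * p (r - 1 + Suc (Suc n)) =
        real r * (\<alpha> + b) * p (r - 1 + Suc n) - real r * \<alpha> * b * p (r - 1 + n)" for n
      using balance[of "r + n"] r unfolding sum prod S_def by (simp add: algebra_simps)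
    from bounded_linear_recurrence[of "real r" b "\<lambda>n. p (r - 1 + n)", OF _ b1 this B] show ?thesis
      using r by simp
  qed
  show "p k = \<alpha> ^ (k - r + 1) * p (r - 1)" if "k \<ge> r"
    using tail[of "k - r + 1"] that r by simp

  define u where "u k = fact k / \<theta> ^ k * p k" for k
  have pu: "p k = \<theta> ^ k / fact k * u k" for k
    using \<theta> by (simp add: u_def)
  \<comment> \<open>For \<open>k < r\<close> neither minimum is cut off, and the scaling by
    \<open>fact k / \<theta> ^ k\<close> absorbs the departure factor \<open>k + 1\<close>.\<close>
  have rec: "\<theta> * u (Suc k) = (\<theta> + real k + \<gamma>) * u k - real k * u (k - 1) - (if k = 0 then \<gamma> else 0)"
    if "k < r" for k
  proof (cases k)
    case 0
    then show ?thesis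
      using balance[of 0] r \<theta> by (simp add: u_def algebra_simps)
  next
    case (Suc m)
    have "(\<theta> + real k + \<gamma>) * p k = \<theta> * p m + real (Suc k) * p (Suc k)"
      using balance[of k] that Suc by simp
    then have "fact k / \<theta> ^ k * ((\<theta> + real k + \<gamma>) * p k) =
        fact k / \<theta> ^ k * (\<theta> * p m + real (Suc k) * p (Suc k))"
      by simp
    then show ?thesis
      using \<theta> unfolding u_def Suc by (simp add: field_simps)
  qed
  define c where "c = u 0 - A_coeff \<theta> \<gamma> 0"
  have u: "u k = A_coeff \<theta> \<gamma> k + c * C_coeff \<theta> \<gamma> k" if "k \<le> r" for k
    unfolding c_def using recurrence_solution[OF \<theta> \<gamma> rec that] by simp
  obtain m where m: "r = Suc m"
    using r by (cases r) auto
  \<comment> \<open>The two regimes overlap at \<open>r\<close>: \<open>u r\<close> still obeys the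
    lower recurrence, while \<open>p r\<close> is the first geometric term. This is the one equation
    that fixes \<open>c\<close>.\<close>
  have "p r = \<alpha> * p m"
    using tail[of 1] m by simp
  then have "\<theta> * u r = real r * \<alpha> * u m"
    using \<theta> unfolding u_def m by (simp add: field_simps)
  then have eq: "c * (\<theta> * C_coeff \<theta> \<gamma> r - real r * \<alpha> * C_coeff \<theta> \<gamma> (r - 1)) =
      - (\<theta> * A_coeff \<theta> \<gamma> r - real r * \<alpha> * A_coeff \<theta> \<gamma> (r - 1))"
    using u[of r] u[of m] m by (simp add: algebra_simps)
  \<comment> \<open>It remains to see that the denominator of \<open>L\<close> is not 0:
    \<open>real r * \<alpha>\<close> is \<open>\<theta> / b\<close>, hence below
    \<open>\<theta>\<close>, and C is positive and nondecreasing.\<close>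
  have "real r * \<alpha> > 0"
    using prod \<theta> b1 by (metis less_trans zero_less_mult_pos2 zero_less_one)
  then have "real r * \<alpha> < \<theta>"
    using prod b1 by (metis mult.right_neutral mult_less_cancel_left_pos)
  then have "real r * \<alpha> * C_coeff \<theta> \<gamma> m < \<theta> * C_coeff \<theta> \<gamma> r"
    using C_coeff_pos_mono[OF \<theta> \<gamma>, of m] \<theta> unfolding m
    by (meson less_le_trans mult_left_mono mult_strict_right_mono less_imp_le)
  then have "c = - L"
    using eq unfolding L m by (simp add: field_simps)
  then show "p k = \<theta> ^ k / fact k * (A_coeff \<theta> \<gamma> k - L * C_coeff \<theta> \<gamma> k)" if "k < r"
    using pu[of k] u[of k] that by simp
qed

section \<open>Existence, uniqueness and form of the stationary distribution\<close>

theorem theorem2p1: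
  fixes r :: nat and lam \<mu> \<kappa> \<theta> \<gamma> \<alpha> L :: real
    and A C :: "nat \<Rightarrow> real" and P :: "real \<Rightarrow> nat \<Rightarrow> nat pmf"
  assumes "r \<ge> 1" and "lam > 0" and "\<mu> > 0" and "\<kappa> > 0"
    and "\<theta> = lam / \<mu>" and "\<gamma> = \<kappa> / \<mu>"
    and "\<alpha> = (real r + \<theta> + \<gamma> - sqrt ((real r + \<theta> + \<gamma>)\<^sup>2 - 4 * \<theta> * real r)) / (2 * real r)"
    and "A = A_coeff \<theta> \<gamma>" and "C = C_coeff \<theta> \<gamma>"
    and "L = (\<theta> * A r - real r * \<alpha> * A (r - 1)) / (\<theta> * C r - real r * \<alpha> * C (r - 1))"
    and "mmr_reset_queue r lam \<mu> \<kappa> P"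
  shows "(\<exists>!p. stationary_distribution P p) \<and>
    (\<forall>p. stationary_distribution P p \<longrightarrow>
       (\<forall>k<r. pmf p k = \<theta> ^ k / fact k * (A k - L * C k)) \<and>
       (\<forall>k\<ge>r. pmf p k = \<alpha> ^ (k - r + 1) * pmf p (r - 1) \<and>
          pmf p k = \<alpha> ^ (k - r + 1) * \<theta> ^ (r - 1) / fact (r - 1) * (A (r - 1) - L * C (r - 1))))"
proof -
  note r = assms(1) and pos = assms(1-4)
  define K where "K = mmr_reset_step r lam \<mu> \<kappa>"
  have P: "transition_function P"
    using assms(11) by (simp add: mmr_reset_queue_def)
  have stationary_iff: "stationary_distribution P p \<longleftrightarrow> bind_pmf p K = p" for p
    unfolding K_def
    by (rule stationary_distribution_iff_uniformization[OF P
          mmr_reset_queue_uniformization[OF pos assms(11)]])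
  have "\<exists>p. bind_pmf p K = p"
    unfolding K_def mmr_reset_step_def using pos
    by (intro resetting_kernel_has_invariant_pmf) (auto simp: add_pos_nonneg)
  then have ex: "\<exists>p. stationary_distribution P p"
    by (simp add: stationary_iff)
  have \<theta>: "\<theta> > 0" and \<gamma>: "\<gamma> > 0"
    using assms by auto
  have rates: "lam = \<mu> * \<theta>" "\<kappa> = \<mu> * \<gamma>"
    using assms by auto
  have formula: "k < r \<Longrightarrow> pmf p k = \<theta> ^ k / fact k * (A k - L * C k)"
    "k \<ge> r \<Longrightarrow> pmf p k = \<alpha> ^ (k - r + 1) * pmf p (r - 1)"
    if "stationary_distribution P p" for p k
  proof -
    have inv: "bind_pmf p (mmr_reset_step r lam \<mu> \<kappa>) = p"
      using that by (simp add: stationary_iff K_def)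
    have balance: "(\<theta> + real (min y r) + \<gamma>) * pmf p y =
      (if y = 0 then \<gamma> else \<theta> * pmf p (y - 1)) + real (min (y + 1) r) * pmf p (y + 1)" for y
    proof -
      have "\<mu> * ((\<theta> + real (min y r) + \<gamma>) * pmf p y) =
        \<mu> * ((if y = 0 then \<gamma> else \<theta> * pmf p (y - 1)) + real (min (y + 1) r) * pmf p (y + 1))"
        using mmr_reset_step_balance[OF pos inv, of y] unfolding rates
        by (cases "y = 0") (simp_all add: algebra_simps)
      then show ?thesis
        using \<open>\<mu> > 0\<close> by (simp only: mult_cancel_left) simp
    qed
    have "\<bar>pmf p k\<bar> \<le> 1" for k
      by (simp add: pmf_le_1)
    note sol = balance_solution[OF r \<theta> \<gamma> assms(7) assms(10)[unfolded assms(8,9)] balance this]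
    show "k < r \<Longrightarrow> pmf p k = \<theta> ^ k / fact k * (A k - L * C k)"
      unfolding assms(8,9) by (rule sol(1))
    show "k \<ge> r \<Longrightarrow> pmf p k = \<alpha> ^ (k - r + 1) * pmf p (r - 1)"
      by (rule sol(2))
  qed
  have last: "pmf p (r - 1) = \<theta> ^ (r - 1) / fact (r - 1) * (A (r - 1) - L * C (r - 1))"
    if "stationary_distribution P p" for p
    using formula(1)[OF that, of "r - 1"] r by simp
  \<comment> \<open>Uniqueness comes from the formulas: below \<open>r\<close> they involve the
    parameters only, and \<open>last\<close> expresses the factor \<open>pmf p (r - 1)\<close> of
    the tail in the same way.\<close>
  have "p = p'" if "stationary_distribution P p" "stationary_distribution P p'" for p p'
  proof (rule pmf_eqI)
    fix k
    show "pmf p k = pmf p' k"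
    proof (cases "k < r")
      case True
      then show ?thesis
        by (simp add: formula(1)[OF that(1)] formula(1)[OF that(2)])
    next
      case False
      then have "k \<ge> r"
        by simp
      then show ?thesis
        by (simp only: formula(2)[OF that(1)] formula(2)[OF that(2)] last[OF that(1)] last[OF that(2)])
    qed
  qed
  with ex have "\<exists>!p. stationary_distribution P p"
    by blast
  moreover have "(\<forall>k<r. pmf p k = \<theta> ^ k / fact k * (A k - L * C k)) \<and>
       (\<forall>k\<ge>r. pmf p k = \<alpha> ^ (k - r + 1) * pmf p (r - 1) \<and>
          pmf p k = \<alpha> ^ (k - r + 1) * \<theta> ^ (r - 1) / fact (r - 1) * (A (r - 1) - L * C (r - 1)))"
    if p: "stationary_distribution P p" for p
  proof (intro conjI allI impI)
    show "pmf p k = \<theta> ^ k / fact k * (A k - L * C k)" if "k < r" for k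
      using formula(1)[OF p that] .
    fix k
    assume "k \<ge> r"
    then show tail: "pmf p k = \<alpha> ^ (k - r + 1) * pmf p (r - 1)"
      by (rule formula(2)[OF p])
    show "pmf p k = \<alpha> ^ (k - r + 1) * \<theta> ^ (r - 1) / fact (r - 1) * (A (r - 1) - L * C (r - 1))"
      unfolding tail last[OF p] by simp
  qed
  ultimately show ?thesis
    by blast
qed

end
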